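(* Let $k\ge 2$, let $0=r_0<r_1<\dots<r_k$ be integers, $d=\gcd(r_1,\dots,r_k)$, $S=\langle r_1,\dots,r_k\rangle$, $N_0=\max\{r_k^2,r_k^2+\operatorname{F}(S)r_k\}$, and let $n>N_0$ be an integer with $\gcd(n,d)=1$. Let $M_n=\langle n,n+r_1,\dots,n+r_k\rangle$. If $f\in\operatorname{PF}(M_n)$ and $f\equiv i\bmod n$ with $i\in\operatorname{Ap}(S,dn)$, then $$\varphi_n(f)=\begin{cases} f+(\mathbf{m}(i)-1)r_k & \text{if } i<dn-r_k,\\ f+(\mathbf{m}(i)+2d-1)r_k+dn & \text{if } i\ge dn-r_k.\end{cases}$$
   Context: $\mathbb{N}$ includes $0$, and $\langle a_1,\dots,a_s\rangle=\{\sum\lambda_i a_i\mid\lambda_i\in\mathbb{N}\}$. For a numerical semigroup $H$, $\operatorname{PF}(H)=\{x\in\mathbb{Z}\setminus H\mid x+h\in H\ \forall\, 0\neq h\in H\}$. $\operatorname{F}(S)=\max\{s\in\mathbb{Z}\setminus S\mid s\equiv0\bmod d\}$ (possibly negative). $\operatorname{Ap}(S,dn)=\{s\in S\mid s-dn\notin S\}$. For $i\in S$, $\mathbf{m}(i)$ is the minimum of $\lambda_1+\dots+\lambda_k$ over all expressions $i=\lambda_1r_1+\dots+\lambda_kr_k$ with $\lambda_j\in\mathbb{N}$. For $n>N_0$ with $\gcd(n,d)=1$: $P_n=\{i\in\operatorname{Ap}(S,dn)\mid f\equiv i\bmod n\text{ for some }f\in\operatorname{PF}(M_n)\}$. Each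 $f\in\operatorname{PF}(M_n)$ is congruent mod $n$ to a unique $i\in P_n$, and this gives a bijection $\operatorname{PF}(M_n)\to P_n$. The map $\psi_n:P_n\to P_{n+r_k}$, $\psi_n(i)=i$ if $i<dn-r_k$ and $\psi_n(i)=i+dr_k$ if $i\ge dn-r_k$, is a bijection, and $\varphi_n:\operatorname{PF}(M_n)\to\operatorname{PF}(M_{n+r_k})$ is the induced bijection: if $f\equiv i\bmod n$ with $i\in P_n$, then $\varphi_n(f)$ is the unique element of $\operatorname{PF}(M_{n+r_k})$ congruent to $\psi_n(i)$ mod $n+r_k$. *)

theory Defs
  imports Complex_Main "HOL-Number_Theory.Cong"
begin

definition generated_by :: "nat set \<Rightarrow> (nat \<Rightarrow> int) \<Rightarrow> int set" where
  "generated_by J a = {\<Sum>j\<in>J. int (c j) * a j | c :: nat \<Rightarrow> nat. True}"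

text \<open>Pseudo-Frobenius numbers; intended for numerical semigroups \<open>H\<close>.\<close>

definition PF :: "int set \<Rightarrow> int set" where
  "PF H = {x. x \<notin> H \<and> (\<forall>h\<in>H. h \<noteq> 0 \<longrightarrow> x + h \<in> H)}"

definition Ap :: "int set \<Rightarrow> int \<Rightarrow> int set" where
  "Ap H m = {s \<in> H. s - m \<notin> H}"

text \<open>
  A sequence \<open>0 = r\<^sub>0 < r\<^sub>1 < \<dots> < r\<^sub>k\<close> is given by a function \<open>r\<close> on the naturals, of which only the
  values at \<open>0, \<dots>, k\<close> matter.
\<close>

definition gcd_r :: "nat \<Rightarrow> (nat \<Rightarrow> int) \<Rightarrow> int" where
  "gcd_r k r = Gcd (r ` {1..k})"

definition S_r :: "nat \<Rightarrow> (nat \<Rightarrow> int) \<Rightarrow> int set" where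
  "S_r k r = generated_by {1..k} r"

text \<open>
  The maximum is over an infinite set that is bounded above, so \<open>Max\<close> is not applicable.
  It is negative (namely \<open>-d\<close>) iff \<open>S\<close> contains all nonnegative multiples of \<open>d\<close>.
\<close>

definition F_r :: "nat \<Rightarrow> (nat \<Rightarrow> int) \<Rightarrow> int" where
  "F_r k r = (GREATEST s. s \<notin> S_r k r \<and> [s = 0] (mod gcd_r k r))"

definition N0 :: "nat \<Rightarrow> (nat \<Rightarrow> int) \<Rightarrow> int" where
  "N0 k r = max ((r k)\<^sup>2) ((r k)\<^sup>2 + F_r k r * r k)"

definition min_len :: "nat \<Rightarrow> (nat \<Rightarrow> int) \<Rightarrow> int \<Rightarrow> nat" where
  "min_len k r i =
     (LEAST t. \<exists>c :: nat \<Rightarrow> nat. i = (\<Sum>j = 1..k. int (c j) * r j) \<and> t = (\<Sum>j = 1..k. c j))"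

text \<open>Since \<open>r\<^sub>0 = 0\<close>, the generator with index \<open>0\<close> is \<open>n\<close> itself.\<close>

definition M :: "nat \<Rightarrow> (nat \<Rightarrow> int) \<Rightarrow> int \<Rightarrow> int set" where
  "M k r n = generated_by {0..k} (\<lambda>j. n + r j)"

definition P :: "nat \<Rightarrow> (nat \<Rightarrow> int) \<Rightarrow> int \<Rightarrow> int set" where
  "P k r n = {i \<in> Ap (S_r k r) (gcd_r k r * n). \<exists>f \<in> PF (M k r n). [f = i] (mod n)}"

definition psi :: "nat \<Rightarrow> (nat \<Rightarrow> int) \<Rightarrow> int \<Rightarrow> int \<Rightarrow> int" where
  "psi k r n i = (if i < gcd_r k r * n - r k then i else i + gcd_r k r * r k)"

definition phi :: "nat \<Rightarrow> (nat \<Rightarrow> int) \<Rightarrow> int \<Rightarrow> int \<Rightarrow> int" where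
  "phi k r n f =
     (THE g. g \<in> PF (M k r (n + r k)) \<and>
        [g = psi k r n (THE i. i \<in> P k r n \<and> [f = i] (mod n))] (mod (n + r k)))"

end

theory Submission
  imports Defs
begin

text \<open>
  Write \<open>r = r\<^sub>k\<close>, and \<open>m(s)\<close> for the least length of an expression of \<open>s \<in> S\<close>. An expression of length \<open>t\<close> in the generators of \<open>M\<^sub>n\<close> has value \<open>t n + s\<close>,
  where \<open>s\<close> is a sum of at most \<open>t\<close> generators of \<open>S\<close>; the generator \<open>n\<close> itself only fills up the
  length. Hence \<open>M\<^sub>n = {t n + s | s \<in> S, m(s) \<le> t}\<close>, and all questions about \<open>M\<^sub>n\<close> become questions
  about \<open>S\<close> and \<open>m\<close>.

  In any list of \<open>r\<close> integers some nonempty block has a sum divisible by \<open>r\<close>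
  (\<open>zero_sum_block\<close>). In an expression, a block of generators smaller than \<open>r\<close> with such a sum can
  be exchanged for fewer copies of \<open>r\<close>, so a shortest expression has fewer than \<open>r\<close> parts different
  from \<open>r\<close>. Three facts follow: \<open>m(x) r \<le> x + (r - 1)\<^sup>2\<close>, while
  \<open>x \<le> m(x) r\<close> because no part exceeds \<open>r\<close>; for \<open>x \<in> S\<close> with
  \<open>x + r > (r - 1)\<^sup>2\<close> adding \<open>r\<close> increases \<open>m\<close> by exactly one; and \<open>S\<close> contains every multiple of
  \<open>d\<close> from \<open>r (r - 1)\<close> on.

  Let \<open>n > r\<^sup>2\<close>. Then \<open>d n \<in> S\<close>, and each \<open>i \<in> Ap(S, d n)\<close> is the least element of \<open>S\<close> in its class
  modulo \<open>n\<close>. The next element of \<open>S\<close> in that class exceeds it by at least \<open>n > (r - 1)\<^sup>2\<close>, so the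
  bounds on \<open>m\<close> show that \<open>i\<close> also has the least length in that class. Therefore
  \<open>i + m(i) n\<close> is the least element of \<open>M\<^sub>n\<close> congruent to \<open>i\<close> (\<open>Apery_minimal\<close>). A pseudo-Frobenius
  number in the class of \<open>i\<close> must lie one step below it, so \<open>f = i + (m(i) - 1) n\<close> (\<open>PF_eq\<close>), and
  this number is pseudo-Frobenius iff \<open>i + a + m(i) n \<in> M\<^sub>n\<close> for every generator \<open>a\<close> of \<open>S\<close>
  (\<open>PF_iff\<close>).

  This criterion is inherited by \<open>\<psi>\<^sub>n(i)\<close> with respect to \<open>n + r\<close> (\<open>PF_step_low\<close>,
  \<open>PF_step_high\<close>). So the same description of pseudo-Frobenius numbers gives
  \<open>\<phi>\<^sub>n(f) = \<psi>\<^sub>n(i) + (m(\<psi>\<^sub>n(i)) - 1) (n + r)\<close>. If \<open>i < d n - r\<close> then \<open>\<psi>\<^sub>n(i) = i\<close>; otherwise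
  \<open>\<psi>\<^sub>n(i) = i + d r\<close> and \<open>m(i + d r) = m(i) + d\<close>. Subtracting \<open>f\<close> gives both formulas.
\<close>

section \<open>Zero-sum blocks\<close>

text \<open>
  Pigeonhole: the \<open>length xs + 1\<close> prefix sums have at most \<open>r\<close> residues, and the part of the list
  between two prefixes with equal residues is the block.
\<close>

lemma zero_sum_block:
  fixes xs :: "int list" and r :: int
  assumes "0 < r" and "r \<le> int (length xs)"
  obtains us vs ws where "xs = us @ vs @ ws" and "vs \<noteq> []" and "r dvd sum_list vs"
proof -
  let ?p = "\<lambda>t. sum_list (take t xs) mod r"
  have "?p ` {0..length xs} \<subseteq> {0..<r}" using assms(1) by auto
  then have "card (?p ` {0..length xs}) \<le> card {0..<r}" by (intro card_mono) auto
  also have "\<dots> < card {0..length xs}" using assms by simp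
  finally have "\<not> inj_on ?p {0..length xs}" by (rule pigeonhole)
  then obtain t t' where "?p t = ?p t'" "t \<noteq> t'" "t \<le> length xs" "t' \<le> length xs"
    unfolding inj_on_def by auto
  then obtain t t' where t: "?p t = ?p t'" "t < t'" "t' \<le> length xs"
    by (metis linorder_neq_iff)
  let ?v = "take (t' - t) (drop t xs)"
  have tk: "take t' xs = take t xs @ ?v"
    using t(2) by (metis le_add_diff_inverse less_imp_le take_add)
  show thesis
  proof
    show "xs = take t xs @ ?v @ drop t' xs"
      using tk by (metis append.assoc append_take_drop_id)
    show "?v \<noteq> []" using t by simp
    have "sum_list ?v = sum_list (take t' xs) - sum_list (take t xs)" using tk by simp
    then show "r dvd sum_list ?v" using t(1)[symmetric] by (simp add: mod_eq_dvd_iff)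
  qed
qed

section \<open>Shortest factorizations\<close>

text \<open>
  Everything depends on the generators only through the set \<open>A\<close> of their values and its largest
  element \<open>r\<close>. Expressions are lists with entries in \<open>A\<close> rather than coefficient vectors, so that
  adding expressions is appending and exchanging a block of parts is splitting a list.
\<close>

locale generators =
  fixes A :: "int set" and r :: int
  assumes A_bounds: "A \<subseteq> {1..r}" and r_in: "r \<in> A"
begin

definition monoid :: "int set" where
  "monoid = {sum_list xs | xs. set xs \<subseteq> A}"

definition len :: "int \<Rightarrow> nat" where
  "len s = (LEAST t. \<exists>xs. set xs \<subseteq> A \<and> s = sum_list xs \<and> t = length xs)"

text \<open>
  The semigroup generated by \<open>n\<close> and all \<open>n + a\<close> with \<open>a \<in> A\<close>: \<open>t\<close> counts all generators used, and
  those that contribute to \<open>s\<close> are the ones different from \<open>n\<close>.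
\<close>

definition shifted :: "int \<Rightarrow> int set" where
  "shifted n = {int t * n + s | t s. s \<in> monoid \<and> len s \<le> t}"

lemma r_pos: "0 < r"
  using A_bounds r_in by auto

lemma monoidI: "set xs \<subseteq> A \<Longrightarrow> sum_list xs \<in> monoid"
  unfolding monoid_def by blast

lemma len_le: "set xs \<subseteq> A \<Longrightarrow> len (sum_list xs) \<le> length xs"
  unfolding len_def by (rule Least_le) blast

lemma shortest:
  assumes "s \<in> monoid"
  obtains xs where "set xs \<subseteq> A" and "sum_list xs = s" and "length xs = len s"
proof -
  have "\<exists>t xs. set xs \<subseteq> A \<and> s = sum_list xs \<and> t = length xs"
    using assms unfolding monoid_def by blast
  then have "\<exists>xs. set xs \<subseteq> A \<and> s = sum_list xs \<and> len s = length xs"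
    unfolding len_def by (rule LeastI_ex)
  with that show thesis by metis
qed

lemma sum_list_bounds:
  "set xs \<subseteq> A \<Longrightarrow> int (length xs) \<le> sum_list xs \<and> sum_list xs \<le> int (length xs) * r"
proof (induction xs)
  case (Cons x xs)
  then have "1 \<le> x" "x \<le> r" using A_bounds by auto
  with Cons show ?case by (auto simp: algebra_simps)
qed simp

lemma monoid_nonneg: "s \<in> monoid \<Longrightarrow> 0 \<le> s"
  unfolding monoid_def using sum_list_bounds by force

lemma monoid_0: "0 \<in> monoid" and len_0: "len 0 = 0"
  using monoidI[of "[]"] len_le[of "[]"] by auto

lemma monoid_add:
  assumes "s \<in> monoid" "t \<in> monoid"
  shows "s + t \<in> monoid" and "len (s + t) \<le> len s + len t"
proof -
  obtain xs ys where "set xs \<subseteq> A" "sum_list xs = s" "length xs = len s"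
    "set ys \<subseteq> A" "sum_list ys = t" "length ys = len t"
    using shortest assms by metis
  then show "s + t \<in> monoid" and "len (s + t) \<le> len s + len t"
    using monoidI[of "xs @ ys"] len_le[of "xs @ ys"] by auto
qed

lemma generator_in: "a \<in> A \<Longrightarrow> a \<in> monoid" and len_generator: "a \<in> A \<Longrightarrow> len a \<le> 1"
  using monoidI[of "[a]"] len_le[of "[a]"] by auto

lemma monoid_mult:
  assumes "s \<in> monoid" shows "int m * s \<in> monoid" and "len (int m * s) \<le> m * len s"
proof (induction m)
  case (Suc m)
  case 1 show ?case using monoid_add(1)[OF assms Suc(1)] by (simp add: algebra_simps)
  case 2 show ?case using monoid_add(2)[OF assms Suc(1)] Suc(2) by (simp add: algebra_simps)
qed (simp_all add: monoid_0 len_0)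

lemma len_lower: "s \<in> monoid \<Longrightarrow> s \<le> int (len s) * r"
  by (metis shortest sum_list_bounds)

text \<open>
  Suppose there are at least \<open>r\<close> parts different from \<open>r\<close>. Some of them form a block with sum
  \<open>r p\<close>. All its entries are smaller than \<open>r\<close>, so \<open>p\<close> is smaller than the number of entries, and \<open>p\<close>
  copies of \<open>r\<close> in place of the block make a shorter expression.
\<close>

lemma shortest_few_small_parts:
  assumes "set xs \<subseteq> A" and "length xs = len (sum_list xs)"
  shows "int (length (filter (\<lambda>x. x \<noteq> r) xs)) < r"
proof (rule ccontr)
  assume "\<not> ?thesis"
  then obtain us vs ws where split: "filter (\<lambda>x. x \<noteq> r) xs = us @ vs @ ws"
    and vs: "vs \<noteq> []" "r dvd sum_list vs"
    using zero_sum_block[OF r_pos] by (metis linorder_not_less)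
  let ?big = "filter (\<lambda>x. \<not> x \<noteq> r) xs"
  have in_f: "set (us @ vs @ ws) \<subseteq> A - {r}" using assms(1) by (auto simp flip: split)
  obtain p where p: "sum_list vs = r * p" using vs(2) by blast
  have "sum_list vs \<le> int (length vs) * (r - 1)"
  proof -
    have "\<forall>x\<in>set vs. x \<le> r - 1" using in_f A_bounds by force
    then show ?thesis by (induction vs) (auto simp: algebra_simps)
  qed
  moreover have "0 < int (length vs)" using vs(1) by simp
  ultimately have "r * p < r * int (length vs)"
    unfolding p right_diff_distrib by (simp only: mult.commute)
  then have "p < int (length vs)" using r_pos by simp
  moreover have "0 \<le> p"
  proof -
    have "0 \<le> sum_list vs" using sum_list_bounds[of vs] in_f by fastforce
    then show ?thesis using p r_pos by (simp add: zero_le_mult_iff)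
  qed
  ultimately obtain q where q: "p = int q" "q < length vs" by (metis nonneg_int_cases of_nat_less_iff)
  let ?ys = "replicate q r @ us @ ws @ ?big"
  have sum_split: "sum_list xs = sum_list (filter P xs) + sum_list (filter (\<lambda>x. \<not> P x) xs)" for P
    by (induction xs) auto
  have "sum_list ?ys = sum_list xs"
    using sum_split[of "\<lambda>x. x \<noteq> r"] unfolding split
    by (simp add: p q sum_list_replicate algebra_simps)
  moreover have "set ?ys \<subseteq> A" using in_f assms(1) r_in by auto
  moreover have "length ?ys < length xs"
    using sum_length_filter_compl[of "\<lambda>x. x \<noteq> r" xs] q(2) unfolding split by simp
  ultimately show False using len_le[of ?ys] assms(2) by simp
qed

text \<open>
  Each part equal to \<open>r\<close> contributes nothing to \<open>len s * r - s\<close>; each of the at most \<open>r - 1\<close> other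
  parts contributes at most \<open>r - 1\<close>.
\<close>

lemma len_upper:
  assumes "s \<in> monoid" shows "int (len s) * r \<le> s + (r - 1)\<^sup>2"
proof -
  obtain xs where xs: "set xs \<subseteq> A" "sum_list xs = s" "length xs = len s"
    using shortest[OF assms] .
  let ?q = "int (length (filter (\<lambda>x. x \<noteq> r) xs))"
  have "int (length xs) * r \<le> sum_list xs + ?q * (r - 1)"
    using xs(1) A_bounds by (induction xs) (auto simp: algebra_simps)
  moreover have "?q * (r - 1) \<le> (r - 1) * (r - 1)"
    using shortest_few_small_parts[of xs] xs r_pos by (intro mult_right_mono) auto
  ultimately show ?thesis using xs by (simp add: power2_eq_square)
qed

text \<open>
  At most \<open>r - 1\<close> parts, all smaller than \<open>r\<close>, cannot sum to more than \<open>(r - 1)\<^sup>2\<close>. So a shortest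
  expression of \<open>s + r\<close> contains \<open>r\<close>, and dropping it gives an expression of \<open>s\<close>.
\<close>

lemma len_add_r:
  assumes "s \<in> monoid" and "(r - 1)\<^sup>2 < s + r"
  shows "len (s + r) = len s + 1"
proof (rule antisym)
  show "len (s + r) \<le> len s + 1"
    using monoid_add(2)[OF assms(1) generator_in[OF r_in]] len_generator[OF r_in] by simp
  obtain xs where xs: "set xs \<subseteq> A" "sum_list xs = s + r" "length xs = len (s + r)"
    using shortest[OF monoid_add(1)[OF assms(1) generator_in[OF r_in]]] .
  have "r \<in> set xs"
  proof (rule ccontr)
    assume no: "r \<notin> set xs"
    then have all_small: "filter (\<lambda>x. x \<noteq> r) xs = xs" by (auto intro: filter_True)
    have few: "int (length xs) \<le> r - 1" using shortest_few_small_parts[of xs] xs all_small by simp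
    have "x \<le> r - 1" if "x \<in> set xs" for x
    proof -
      have "x \<le> r" "x \<noteq> r" using that no xs(1) A_bounds by auto
      then show ?thesis by simp
    qed
    then have "sum_list xs \<le> int (length xs) * (r - 1)"
      by (induction xs) (force simp: algebra_simps)+
    also have "\<dots> \<le> (r - 1) * (r - 1)" using few r_pos by (intro mult_right_mono) auto
    finally show False using assms(2) xs(2) by (simp add: power2_eq_square)
  qed
  then obtain us ws where "xs = us @ r # ws" by (auto dest: split_list)
  then show "len s + 1 \<le> len (s + r)" using xs len_le[of "us @ ws"] by auto
qed

lemma len_add_mult_r:
  assumes "s \<in> monoid" and "(r - 1)\<^sup>2 < s + r"
  shows "len (s + int m * r) = len s + m"
proof (induction m)
  case (Suc m)
  let ?x = "s + int m * r"
  have "?x \<in> monoid" using monoid_add(1)[OF assms(1) monoid_mult(1)[OF generator_in[OF r_in]]] .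
  moreover have "s \<le> ?x" using r_pos by simp
  ultimately have "len (?x + r) = len ?x + 1" using assms(2) by (intro len_add_r) auto
  then show ?case using Suc by (simp add: algebra_simps)
qed simp

section \<open>The multiples of the greatest common divisor\<close>

lemma Gcd_pos: "0 < Gcd A"
proof -
  have "Gcd A \<noteq> 0" using r_in r_pos by (auto simp: Gcd_0_iff)
  then show ?thesis using Gcd_int_greater_eq_0[of A] by linarith
qed

lemma Gcd_dvd_monoid: "s \<in> monoid \<Longrightarrow> Gcd A dvd s"
proof -
  have "set xs \<subseteq> A \<Longrightarrow> Gcd A dvd sum_list xs" for xs by (induction xs) auto
  then show "s \<in> monoid \<Longrightarrow> Gcd A dvd s" unfolding monoid_def by blast
qed

text \<open>
  Modulo \<open>r\<close> a negative coefficient may be replaced by its nonnegative residue. So the integers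
  congruent to elements of the monoid form an ideal, which contains \<open>Gcd A\<close> by Bezout's identity.
\<close>

lemma residue_attained:
  assumes "Gcd A dvd x"
  shows "\<exists>s\<in>monoid. [s = x] (mod r)"
proof -
  define G where "G = {x. \<exists>s\<in>monoid. [s = x] (mod r)}"
  have add: "x + y \<in> G" if "x \<in> G" "y \<in> G" for x y
    using that monoid_add(1) cong_add unfolding G_def by blast
  have mult: "u * x \<in> G" if x: "x \<in> G" for u x
  proof -
    obtain s where s: "s \<in> monoid" "[s = x] (mod r)" using x unfolding G_def by blast
    have "int (nat (u mod r)) * s \<in> monoid" using s(1) by (rule monoid_mult)
    moreover have "[int (nat (u mod r)) * s = u * x] (mod r)"
      using s(2) r_pos by (intro cong_mult) auto
    ultimately show ?thesis unfolding G_def by blast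
  qed
  have "Gcd B \<in> G" if "finite B" "B \<subseteq> A" for B
    using that
  proof (induction B)
    case empty
    then show ?case using monoid_0 by (auto simp: G_def intro!: bexI[of _ 0])
  next
    case (insert a B)
    obtain u v where "u * a + v * Gcd B = gcd a (Gcd B)" using bezout_int by blast
    moreover have "a \<in> G" using insert.prems generator_in[of a] by (auto simp: G_def intro!: bexI[of _ a])
    ultimately show ?case using add[OF mult mult, of a "Gcd B" u v] insert by simp
  qed
  moreover have "finite A" using A_bounds finite_subset by blast
  ultimately have "Gcd A \<in> G" by blast
  moreover obtain u where "x = u * Gcd A" using assms by (metis dvdE mult.commute)
  ultimately have "x \<in> G" using mult by blast
  then show ?thesis unfolding G_def by blast
qed

text \<open>
  A shortest list whose sum has the residue of \<open>x\<close> contains no block with sum divisible by \<open>r\<close>, so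
  it has at most \<open>r - 1\<close> entries and its sum is at most \<open>r (r - 1)\<close>. The difference to \<open>x\<close> is made
  up by copies of \<open>r\<close>.
\<close>

lemma large_multiples_in:
  assumes "Gcd A dvd x" and "r * (r - 1) \<le> x"
  shows "x \<in> monoid"
proof -
  let ?Q = "\<lambda>xs. set xs \<subseteq> A \<and> [sum_list xs = x] (mod r)"
  have "\<exists>xs. ?Q xs" using residue_attained[OF assms(1)] unfolding monoid_def by blast
  then obtain xs where xs: "?Q xs" and least: "\<And>ys. ?Q ys \<Longrightarrow> length xs \<le> length ys"
    using ex_has_least_nat[of ?Q _ length] by metis
  have "int (length xs) < r"
  proof (rule ccontr)
    assume "\<not> ?thesis"
    then obtain us vs ws where split: "xs = us @ vs @ ws" "vs \<noteq> []" "r dvd sum_list vs"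
      using zero_sum_block[OF r_pos] by (metis linorder_not_less)
    have "[sum_list (us @ ws) = sum_list xs] (mod r)"
      using split by (simp add: cong_iff_dvd_diff)
    then have "?Q (us @ ws)" using xs split(1) cong_trans by auto
    then show False using least split by fastforce
  qed
  then have "int (length xs) * r \<le> (r - 1) * r" using r_pos by (intro mult_right_mono) auto
  then have "sum_list xs \<le> x" using sum_list_bounds xs assms(2) by (fastforce simp: mult.commute)
  moreover obtain p where p: "x - sum_list xs = r * p"
    using xs by (metis cong_iff_dvd_diff cong_sym dvdE)
  ultimately have "0 \<le> p" using r_pos by (metis diff_ge_0_iff_ge zero_le_mult_iff not_less)
  then have "x = sum_list xs + int (nat p) * r" using p by (simp add: algebra_simps)
  then show ?thesis
    using monoid_add(1)[OF monoidI monoid_mult(1)[OF generator_in[OF r_in]]] xs by metis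
qed

section \<open>Apery sets\<close>

lemma shiftedI: "s \<in> monoid \<Longrightarrow> len s \<le> t \<Longrightarrow> int t * n + s \<in> shifted n"
  unfolding shifted_def by blast

lemma shifted_add:
  assumes "x \<in> shifted n" "y \<in> shifted n" shows "x + y \<in> shifted n"
proof -
  obtain t s t' s' where "x = int t * n + s" "s \<in> monoid" "len s \<le> t"
    "y = int t' * n + s'" "s' \<in> monoid" "len s' \<le> t'"
    using assms unfolding shifted_def by blast
  then show ?thesis
    using shiftedI[of "s + s'" "t + t'" n] monoid_add[of s s'] by (simp add: algebra_simps)
qed

lemma mult_in_shifted: "0 \<le> p \<Longrightarrow> p * n \<in> shifted n"
  using shiftedI[of 0 "nat p" n] by (simp add: monoid_0 len_0)

lemma r_square_bound: "(r - 1)\<^sup>2 < r\<^sup>2" "r * (r - 1) < r\<^sup>2"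
  using r_pos by (auto simp: power2_eq_square algebra_simps)

text \<open>
  Elements of the monoid are multiples of \<open>Gcd A\<close>, so a congruence modulo \<open>n\<close> between them is one
  modulo \<open>Gcd A * n\<close>. If \<open>s\<close> were below \<open>i\<close>, adding copies of \<open>Gcd A * n\<close>, which lies in the monoid,
  would reach \<open>i - Gcd A * n\<close>, which does not.
\<close>

lemma Ap_gap:
  assumes "r\<^sup>2 < n" and "coprime n (Gcd A)"
    and "i \<in> Ap monoid (Gcd A * n)" and "s \<in> monoid" and "[s = i] (mod n)"
  shows "s = i \<or> i + Gcd A * n \<le> s"
proof -
  let ?d = "Gcd A"
  have i: "i \<in> monoid" "i - ?d * n \<notin> monoid" using assms(3) by (auto simp: Ap_def)
  have npos: "0 < n" using assms(1) zero_le_power2[of r] by linarith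
  then have "n \<le> ?d * n" using Gcd_pos by simp
  then have dn: "?d * n \<in> monoid" using assms(1) r_square_bound by (intro large_multiples_in) auto
  have "?d dvd s - i" using Gcd_dvd_monoid i(1) assms(4) by simp
  moreover have "n dvd s - i" using assms(5) by (simp add: cong_iff_dvd_diff)
  ultimately have "?d * n dvd s - i" using assms(2) by (intro divides_mult) (auto simp: coprime_commute)
  then obtain q where q: "s - i = ?d * n * q" by blast
  have "\<not> q < 0"
  proof
    assume "q < 0"
    \<comment> \<open>\<open>s\<close> is \<open>- q\<close> steps below \<open>i\<close>, hence \<open>- q - 1\<close> steps below \<open>i - ?d * n\<close>.\<close>
    then have "s + int (nat (- q - 1)) * (?d * n) = i - ?d * n"
      using q by (simp add: algebra_simps)
    then show False using monoid_add(1)[OF assms(4) monoid_mult(1)[OF dn]] i(2) by metis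
  qed
  then consider "q = 0" | "1 \<le> q" by linarith
  then show ?thesis
  proof cases
    case 2
    then have "?d * n * 1 \<le> ?d * n * q" using npos Gcd_pos by (intro mult_left_mono) auto
    then show ?thesis using q by simp
  qed (use q in simp)
qed

lemma Ap_unique:
  assumes "r\<^sup>2 < n" and "coprime n (Gcd A)"
    and "i \<in> Ap monoid (Gcd A * n)" and "j \<in> Ap monoid (Gcd A * n)" and "[i = j] (mod n)"
  shows "i = j"
proof -
  have "0 < n" using assms(1) zero_le_power2[of r] by linarith
  then have "0 < Gcd A * n" using Gcd_pos by simp
  then show ?thesis
    using Ap_gap[OF assms(1,2,3), of j] Ap_gap[OF assms(1,2,4), of i] assms(3-5)
    by (auto simp: Ap_def cong_sym)
qed

text \<open>
  An element \<open>t n + s\<close> of the same class has \<open>s = i\<close> or \<open>s \<ge> i + n\<close>. In the second case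
  \<open>len i * r \<le> i + (r - 1)\<^sup>2 < s \<le> len s * r\<close>, so a larger \<open>s\<close> does not allow a smaller \<open>t\<close>.
\<close>

lemma Apery_minimal:
  assumes n: "r\<^sup>2 < n" "coprime n (Gcd A)"
    and i: "i \<in> Ap monoid (Gcd A * n)" and x: "x \<in> shifted n" "[x = i] (mod n)"
  shows "i + int (len i) * n \<le> x"
proof -
  obtain t s where s: "x = int t * n + s" "s \<in> monoid" "len s \<le> t"
    using x(1) unfolding shifted_def by blast
  have npos: "0 < n" using n(1) zero_le_power2[of r] by linarith
  have "[s = i] (mod n)"
    using x(2) s(1) by (simp add: cong_def)
  then consider "s = i" | "i + Gcd A * n \<le> s" using Ap_gap[OF n i s(2)] by blast
  then have "len i \<le> len s \<and> i \<le> s"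
  proof cases
    case 2
    have dn: "n \<le> Gcd A * n" using npos Gcd_pos by simp
    have "int (len i) * r \<le> i + (r - 1)\<^sup>2" using len_upper i by (simp add: Ap_def)
    also have "\<dots> < i + n" using n(1) r_square_bound by simp
    also have "\<dots> \<le> s" using 2 dn by simp
    also have "s \<le> int (len s) * r" using len_lower[OF s(2)] .
    finally have "int (len i) < int (len s)" using r_pos by simp
    then show ?thesis using 2 dn npos by linarith
  qed simp
  moreover from this have "int (len i) * n \<le> int t * n"
    using s(3) npos by (intro mult_right_mono) auto
  ultimately show ?thesis using s(1) by linarith
qed

section \<open>Pseudo-Frobenius numbers\<close>

text \<open>
  The larger of two congruent pseudo-Frobenius numbers would arise from the smaller one by adding a
  nonzero multiple of \<open>n\<close>, hence an element of the semigroup.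
\<close>

lemma PF_unique:
  assumes "0 < n" and "f \<in> PF (shifted n)" "g \<in> PF (shifted n)" and "[f = g] (mod n)"
  shows "f = g"
proof -
  have no: "\<not> f < g" if fg: "f \<in> PF (shifted n)" "g \<in> PF (shifted n)" "[f = g] (mod n)" for f g
  proof
    assume "f < g"
    obtain p where p: "g - f = n * p" using fg(3) by (metis cong_iff_dvd_diff cong_sym dvdE)
    then have "0 < p" using \<open>f < g\<close> assms(1) by (metis diff_gt_0_iff_gt zero_less_mult_pos)
    then have "p * n \<in> shifted n" "p * n \<noteq> 0" using mult_in_shifted assms(1) by auto
    then have "f + p * n \<in> shifted n" using fg(1) by (simp add: PF_def)
    then show False using p fg(2) by (simp add: PF_def algebra_simps)
  qed
  show ?thesis using no[OF assms(2-4)] no[OF assms(3,2) cong_sym[OF assms(4)]] by simp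
qed

text \<open>
  \<open>f\<close> is outside the semigroup but \<open>f + n\<close> is inside, so \<open>f + n\<close> is the least element of its class.
\<close>

lemma PF_eq:
  assumes n: "r\<^sup>2 < n" "coprime n (Gcd A)" and i: "i \<in> Ap monoid (Gcd A * n)"
    and f: "f \<in> PF (shifted n)" "[f = i] (mod n)"
  shows "f = i + (int (len i) - 1) * n"
proof -
  let ?w = "i + int (len i) * n"
  have npos: "0 < n" using n(1) zero_le_power2[of r] by linarith
  have w: "?w \<in> shifted n" using shiftedI[of i "len i" n] i by (simp add: Ap_def add.commute)
  have "f + n \<in> shifted n"
    using f(1) npos mult_in_shifted[of 1 n] by (simp add: PF_def)
  moreover have "[f + n = i] (mod n)" using f(2) by (simp add: cong_def)
  ultimately have ge: "?w \<le> f + n" by (rule Apery_minimal[OF n i])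
  have "n dvd f - i" using f(2) by (simp add: cong_iff_dvd_diff)
  then obtain p where p: "f - i = n * p" by blast
  have "p < int (len i)"
  proof (rule ccontr)
    assume "\<not> ?thesis"
    then have "?w + (p - int (len i)) * n \<in> shifted n"
      by (intro shifted_add w mult_in_shifted) simp
    moreover have "?w + (p - int (len i)) * n = f" using p by (simp add: algebra_simps)
    ultimately show False using f(1) by (simp add: PF_def)
  qed
  moreover have "int (len i) * n \<le> (p + 1) * n" using ge p by (simp add: algebra_simps)
  then have "int (len i) \<le> p + 1" using npos by simp
  ultimately have "p = int (len i) - 1" by simp
  then have "f - i = n * (int (len i) - 1)" using p by simp
  then show ?thesis by (simp add: algebra_simps)
qed

text \<open>
  It suffices to test the generators \<open>n\<close> and \<open>n + a\<close> in place of all nonzero elements. The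
  generator \<open>n\<close> leads to \<open>i + len i * n\<close>, which is always in the semigroup.
\<close>

lemma PF_iff:
  assumes n: "r\<^sup>2 < n" "coprime n (Gcd A)" and i: "i \<in> Ap monoid (Gcd A * n)"
  shows "i + (int (len i) - 1) * n \<in> PF (shifted n) \<longleftrightarrow>
    (\<forall>a\<in>A. i + a + int (len i) * n \<in> shifted n)" (is "?f \<in> _ \<longleftrightarrow> _")
proof
  have npos: "0 < n" using n(1) zero_le_power2[of r] by linarith
  show "\<forall>a\<in>A. i + a + int (len i) * n \<in> shifted n" if f: "?f \<in> PF (shifted n)"
  proof
    fix a assume a: "a \<in> A"
    have "n + a \<in> shifted n" using shiftedI[OF generator_in[OF a] len_generator[OF a], of n] by simp
    moreover have "n + a \<noteq> 0" using npos a A_bounds by force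
    ultimately have "?f + (n + a) \<in> shifted n" using f by (simp add: PF_def)
    then show "i + a + int (len i) * n \<in> shifted n" by (simp add: algebra_simps)
  qed
  assume gens: "\<forall>a\<in>A. i + a + int (len i) * n \<in> shifted n"
  have "?f \<notin> shifted n"
  proof
    assume "?f \<in> shifted n"
    then have "i + int (len i) * n \<le> ?f"
      by (rule Apery_minimal[OF n i]) (simp add: cong_iff_dvd_diff)
    then show False using npos by (simp add: algebra_simps)
  qed
  moreover have "?f + h \<in> shifted n" if h: "h \<in> shifted n" "h \<noteq> 0" for h
  proof -
    obtain t s where s: "h = int t * n + s" "s \<in> monoid" "len s \<le> t"
      using h(1) unfolding shifted_def by blast
    obtain xs where xs: "set xs \<subseteq> A" "sum_list xs = s" "length xs = len s"
      using shortest[OF s(2)] .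
    have "t \<noteq> 0"
    proof
      assume "t = 0"
      then have "xs = []" using s(3) xs(3) by simp
      then show False using s(1) xs(2) h(2) \<open>t = 0\<close> by simp
    qed
    then obtain t' where t': "t = Suc t'" by (cases t) auto
    show ?thesis
    proof (cases xs)
      case Nil
      have "i + int (len i) * n \<in> shifted n"
        using shiftedI[of i "len i" n] i by (simp add: Ap_def add.commute)
      then have "(i + int (len i) * n) + int t' * n \<in> shifted n"
        by (rule shifted_add) (simp add: mult_in_shifted)
      moreover have "?f + h = (i + int (len i) * n) + int t' * n"
        using Nil s(1) xs(2) t' by (simp add: algebra_simps)
      ultimately show ?thesis by (simp only:)
    next
      case (Cons a ys)
      have "int t' * n + sum_list ys \<in> shifted n"
        using Cons xs s(3) t' len_le[of ys] by (intro shiftedI monoidI) auto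
      then have "(i + a + int (len i) * n) + (int t' * n + sum_list ys) \<in> shifted n"
        using gens xs(1) Cons by (intro shifted_add[of "i + a + int (len i) * n"]) auto
      moreover have "?f + h = (i + a + int (len i) * n) + (int t' * n + sum_list ys)"
        using Cons s(1) xs(2) t' by (auto simp: algebra_simps)
      ultimately show ?thesis by (simp only:)
    qed
  qed
  ultimately show "?f \<in> PF (shifted n)" by (simp add: PF_def)
qed

section \<open>Passing from \<open>n\<close> to \<open>n + r\<close>\<close>

lemma len_le_of_shifted:
  assumes n: "r\<^sup>2 < n" "coprime n (Gcd A)" and x: "x \<in> Ap monoid (Gcd A * n)"
    and "x + int t * n \<in> shifted n"
  shows "len x \<le> t"
proof -
  have "0 < n" using n(1) zero_le_power2[of r] by linarith
  moreover have "x + int (len x) * n \<le> x + int t * n"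
    using Apery_minimal[OF n x assms(4)] by (simp add: cong_iff_dvd_diff)
  ultimately show ?thesis by simp
qed

lemma coprime_add_r: "coprime n (Gcd A) \<Longrightarrow> coprime (n + r) (Gcd A)"
proof -
  assume n: "coprime n (Gcd A)"
  obtain q where "r = Gcd A * q" using Gcd_dvd[OF r_in] by blast
  then have "gcd (n + r) (Gcd A) = gcd n (Gcd A)"
    using gcd_add_mult[of "Gcd A" q n] by (simp add: gcd.commute ac_simps)
  then show ?thesis using n by (simp add: coprime_iff_gcd_eq_1)
qed

text \<open>
  Here \<open>i + a < Gcd A * n\<close> for every generator \<open>a\<close>, so \<open>i + a\<close> lies in the Apery set and the criterion
  for \<open>i\<close> says \<open>len (i + a) \<le> len i\<close>. This condition does not mention \<open>n\<close>.
\<close>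

lemma PF_step_low:
  assumes n: "r\<^sup>2 < n" "coprime n (Gcd A)" and i: "i \<in> Ap monoid (Gcd A * n)"
    and f: "i + (int (len i) - 1) * n \<in> PF (shifted n)" and low: "i < Gcd A * n - r"
  shows "i + (int (len i) - 1) * (n + r) \<in> PF (shifted (n + r))"
proof -
  let ?d = "Gcd A"
  have "0 < ?d * r" using Gcd_pos r_pos by simp
  then have "i - ?d * (n + r) < 0" using low r_pos by (simp add: algebra_simps)
  then have i': "i \<in> Ap monoid (?d * (n + r))"
    using i monoid_nonneg[of "i - ?d * (n + r)"] by (auto simp: Ap_def)
  have "coprime (n + r) ?d" using coprime_add_r[OF n(2)] .
  moreover have "r\<^sup>2 < n + r" using n(1) r_pos by simp
  moreover have "i + a + int (len i) * (n + r) \<in> shifted (n + r)" if a: "a \<in> A" for a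
  proof -
    have ia: "i + a \<in> monoid" using i a monoid_add(1) generator_in by (simp add: Ap_def)
    moreover have "i + a - ?d * n \<notin> monoid"
      using low a A_bounds monoid_nonneg[of "i + a - ?d * n"] by force
    ultimately have "i + a \<in> Ap monoid (?d * n)" by (simp add: Ap_def)
    then have "len (i + a) \<le> len i"
      using PF_iff[OF n i] f a by (intro len_le_of_shifted[OF n]) auto
    then show ?thesis using shiftedI[OF ia, of "len i" "n + r"] by (simp add: add.commute)
  qed
  ultimately show "i + (int (len i) - 1) * (n + r) \<in> PF (shifted (n + r))"
    using PF_iff[OF _ _ i'] by blast
qed

text \<open>
  Since \<open>i\<close> is large, passing to \<open>i'\<close> increases the length by exactly \<open>Gcd A\<close>. If \<open>i + a\<close> lies in the
  Apery set, the criterion for \<open>i\<close> is \<open>len (i + a) \<le> len i\<close>, and adding \<open>Gcd A\<close> copies of \<open>r\<close> to both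
  sides gives the one for \<open>i'\<close>. Otherwise \<open>i + a - Gcd A * n\<close> is in the monoid. It is so much
  smaller than \<open>i'\<close> that its length is at most \<open>len i'\<close>, and \<open>len i' + Gcd A\<close> is all that the
  criterion for \<open>i'\<close> asks of it.
\<close>

lemma PF_step_high:
  assumes n: "r\<^sup>2 < n" "coprime n (Gcd A)" and i: "i \<in> Ap monoid (Gcd A * n)"
    and f: "i + (int (len i) - 1) * n \<in> PF (shifted n)" and high: "Gcd A * n - r \<le> i"
  defines "i' \<equiv> i + Gcd A * r"
  shows "int (len i') = int (len i) + Gcd A"
    and "i' + (int (len i') - 1) * (n + r) \<in> PF (shifted (n + r))"
proof -
  obtain d where d: "Gcd A = int d" using Gcd_pos by (metis nonneg_int_cases less_imp_le)
  have dpos: "1 \<le> int d" using Gcd_pos d by simp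
  have npos: "0 < n" using n(1) zero_le_power2[of r] by linarith
  have dn: "n \<le> int d * n" using dpos npos by simp
  have im: "i \<in> monoid" "i - int d * n \<notin> monoid" using i d by (auto simp: Ap_def)
  have dr: "int d * r \<in> monoid" using monoid_mult(1)[OF generator_in[OF r_in]] .
  have len_dr: "len (int d * r) \<le> d"
    using monoid_mult(2)[OF generator_in[OF r_in], of d] len_generator[OF r_in]
      mult_le_mono2[of "len r" 1 d] by linarith
  have i': "i' \<in> Ap monoid (Gcd A * (n + r))"
    using monoid_add(1)[OF im(1) dr] im(2) by (simp add: Ap_def i'_def d algebra_simps)
  have "(r - 1)\<^sup>2 < i + r" using high[unfolded d] dn n(1) r_square_bound by linarith
  then have leni': "len i' = len i + d"
    using len_add_mult_r[OF im(1)] by (simp add: i'_def d)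
  then show "int (len i') = int (len i) + Gcd A" by (simp add: d)
  have "coprime (n + r) (Gcd A)" using coprime_add_r[OF n(2)] .
  moreover have "r\<^sup>2 < n + r" using n(1) r_pos by simp
  moreover have "i' + a + int (len i') * (n + r) \<in> shifted (n + r)" if a: "a \<in> A" for a
  proof (cases "i + a - int d * n \<in> monoid")
    case True
    let ?y = "i + a - int d * n"
    have "a \<le> r" using a A_bounds by auto
    have "int (len ?y) * r \<le> ?y + (r - 1)\<^sup>2" using len_upper[OF True] .
    also have "\<dots> \<le> ?y + n" using n(1) r_square_bound by simp
    also have "\<dots> \<le> i + int d * r"
    proof -
      have "1 * r \<le> int d * r" using dpos r_pos by (intro mult_right_mono) auto
      then show ?thesis using dn \<open>a \<le> r\<close> by simp
    qed
    also have "\<dots> \<le> int (len i') * r"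
      using len_lower[of i'] i' by (simp add: Ap_def i'_def d)
    finally have "len ?y \<le> len i' + d" using r_pos by simp
    \<comment> \<open>\<open>i' + a\<close> is \<open>?y\<close> plus \<open>d\<close> copies of \<open>n + r\<close>, so \<open>?y\<close> may use \<open>d\<close> more generators than \<open>i'\<close>.\<close>
    then have "int (len i' + d) * (n + r) + ?y \<in> shifted (n + r)" using True by (intro shiftedI)
    then show ?thesis by (simp add: i'_def d algebra_simps)
  next
    case False
    have ia: "i + a \<in> monoid" using im(1) a monoid_add(1) generator_in by simp
    then have "i + a \<in> Ap monoid (Gcd A * n)" using False by (simp add: Ap_def d)
    then have "len (i + a) \<le> len i"
      using PF_iff[OF n i] f a by (intro len_le_of_shifted[OF n]) auto
    then have "len (i + a + int d * r) \<le> len i'"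
      using monoid_add(2)[OF ia dr] len_dr leni' by simp
    then have "int (len i') * (n + r) + (i + a + int d * r) \<in> shifted (n + r)"
      using monoid_add(1)[OF ia dr] by (intro shiftedI)
    then show ?thesis by (simp add: i'_def d algebra_simps)
  qed
  ultimately show "i' + (int (len i') - 1) * (n + r) \<in> PF (shifted (n + r))"
    using PF_iff[OF _ _ i'] by blast
qed

end

section \<open>Coefficients and lists\<close>

lemma coefficients_iff_list:
  fixes r :: "nat \<Rightarrow> int"
  shows "(\<exists>c :: nat \<Rightarrow> nat. s = (\<Sum>j=1..k. int (c j) * r j) \<and> t = (\<Sum>j=1..k. c j)) \<longleftrightarrow>
    (\<exists>xs. set xs \<subseteq> r ` {1..k} \<and> s = sum_list xs \<and> t = length xs)"
proof
  assume "\<exists>c :: nat \<Rightarrow> nat. s = (\<Sum>j=1..k. int (c j) * r j) \<and> t = (\<Sum>j=1..k. c j)"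
  then obtain c :: "nat \<Rightarrow> nat" where
    c: "s = (\<Sum>j=1..k. int (c j) * r j)" "t = (\<Sum>j=1..k. c j)" by blast
  let ?xs = "concat (map (\<lambda>j. replicate (c j) (r j)) [1..<Suc k])"
  have "sum_list (concat (map (\<lambda>j. replicate (c j) (r j)) js)) = (\<Sum>j\<leftarrow>js. int (c j) * r j)" for js
    by (induction js) (auto simp: sum_list_replicate)
  moreover have "length ?xs = (\<Sum>j\<leftarrow>[1..<Suc k]. c j)"
    by (simp add: length_concat comp_def del: upt_Suc)
  moreover have "set ?xs \<subseteq> r ` {1..k}" by auto
  ultimately show "\<exists>xs. set xs \<subseteq> r ` {1..k} \<and> s = sum_list xs \<and> t = length xs"
    using c by (intro exI[of _ ?xs])
      (simp add: interv_sum_list_conv_sum_set_nat atLeastLessThanSuc_atLeastAtMost del: upt_Suc)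
next
  assume "\<exists>xs. set xs \<subseteq> r ` {1..k} \<and> s = sum_list xs \<and> t = length xs"
  then obtain xs where "set xs \<subseteq> r ` {1..k}" "s = sum_list xs" "t = length xs" by blast
  then show "\<exists>c :: nat \<Rightarrow> nat. s = (\<Sum>j=1..k. int (c j) * r j) \<and> t = (\<Sum>j=1..k. c j)"
  proof (induction xs arbitrary: s t)
    case Nil
    then show ?case by (intro exI[of _ "\<lambda>_. 0"]) simp
  next
    case (Cons x xs)
    then obtain c :: "nat \<Rightarrow> nat" where
      c: "sum_list xs = (\<Sum>j=1..k. int (c j) * r j)" "length xs = (\<Sum>j=1..k. c j)" by fastforce
    obtain l where l: "l \<in> {1..k}" "x = r l" using Cons.prems by auto
    let ?c = "\<lambda>j. c j + (if j = l then 1 else 0)"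
    have "(\<Sum>j=1..k. int (?c j) * r j) = (\<Sum>j=1..k. int (c j) * r j + (if j = l then r j else 0))"
      by (intro sum.cong) (auto simp: algebra_simps)
    also have "\<dots> = s" using c l Cons.prems by (simp add: sum.distrib)
    finally have "s = (\<Sum>j=1..k. int (?c j) * r j)" by simp
    moreover have "t = (\<Sum>j=1..k. ?c j)" using c l Cons.prems by (simp add: sum.distrib)
    ultimately show ?case by (intro exI[of _ ?c]) simp
  qed
qed

context
  fixes k :: nat and r :: "nat \<Rightarrow> int"
  assumes k: "1 \<le> k" and r0: "r 0 = 0" and mono: "strict_mono_on {0..k} r"
begin

lemma generators_r: "generators (r ` {1..k}) (r k)"
proof
  show "r k \<in> r ` {1..k}" using k by simp
  have "1 \<le> r j \<and> r j \<le> r k" if "j \<in> {1..k}" for j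
    using that strict_mono_onD[OF mono, of 0 j] strict_mono_onD[OF mono, of j k] r0
    by (cases "j = k") auto
  then show "r ` {1..k} \<subseteq> {1..r k}" by auto
qed

interpretation generators "r ` {1..k}" "r k" by (rule generators_r)

lemma S_r_eq: "S_r k r = monoid"
  unfolding S_r_def generated_by_def monoid_def
proof (intro set_eqI iffI; elim CollectE exE conjE)
  fix x and c :: "nat \<Rightarrow> nat" assume "x = (\<Sum>j=1..k. int (c j) * r j)"
  then show "x \<in> {sum_list xs | xs. set xs \<subseteq> r ` {1..k}}"
    using coefficients_iff_list[of x r k "\<Sum>j=1..k. c j"] by blast
next
  fix x xs assume "x = sum_list xs" "set xs \<subseteq> r ` {1..k}"
  then show "x \<in> {\<Sum>j=1..k. int (c j) * r j | c :: nat \<Rightarrow> nat. True}"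
    using coefficients_iff_list[of x r k "length xs"] by blast
qed

lemma min_len_eq: "min_len k r i = len i"
  unfolding min_len_def len_def coefficients_iff_list ..

lemma M_eq: "M k r n = shifted n"
proof -
  have split: "(\<Sum>j=0..k. int (c j) * (n + r j)) =
    int (c 0 + (\<Sum>j=1..k. c j)) * n + (\<Sum>j=1..k. int (c j) * r j)" for c :: "nat \<Rightarrow> nat"
    using r0 by (simp add: sum.atLeast_Suc_atMost sum_distrib_left sum.distrib algebra_simps)
  show ?thesis
  proof (intro equalityI subsetI)
    fix x assume "x \<in> M k r n"
    then obtain c :: "nat \<Rightarrow> nat" where "x = (\<Sum>j=0..k. int (c j) * (n + r j))"
      unfolding M_def generated_by_def by blast
    then have x: "x = int (c 0 + (\<Sum>j=1..k. c j)) * n + (\<Sum>j=1..k. int (c j) * r j)"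
      using split by simp
    obtain xs where "set xs \<subseteq> r ` {1..k}" "(\<Sum>j=1..k. int (c j) * r j) = sum_list xs"
      "(\<Sum>j=1..k. c j) = length xs"
      using coefficients_iff_list[of "\<Sum>j=1..k. int (c j) * r j" r k "\<Sum>j=1..k. c j"] by blast
    then show "x \<in> shifted n" unfolding x using monoidI[of xs] len_le[of xs]
      by (intro shiftedI) (metis, metis trans_le_add2)
  next
    fix x assume "x \<in> shifted n"
    then obtain t s where s: "x = int t * n + s" "s \<in> monoid" "len s \<le> t"
      unfolding shifted_def by blast
    have "\<exists>xs. set xs \<subseteq> r ` {1..k} \<and> s = sum_list xs \<and> len s = length xs"
      using shortest[OF s(2)] by metis
    then obtain c :: "nat \<Rightarrow> nat" where
      c: "s = (\<Sum>j=1..k. int (c j) * r j)" "len s = (\<Sum>j=1..k. c j)"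
      unfolding coefficients_iff_list[symmetric] by blast
    \<comment> \<open>The generator \<open>n\<close>, which has index \<open>0\<close>, fills the expression of \<open>s\<close> up to length \<open>t\<close>.\<close>
    let ?c = "c(0 := t - len s)"
    have "x = (\<Sum>j=0..k. int (?c j) * (n + r j))"
      unfolding split using s(1,3) c by simp
    then show "x \<in> M k r n" unfolding M_def generated_by_def by blast
  qed
qed

text \<open>
  Both descriptions in the definition of \<open>\<phi>\<^sub>n\<close> are unique: elements of the Apery set, and
  pseudo-Frobenius numbers, are determined by their residues. So a single pseudo-Frobenius number in
  the class of \<open>\<psi>\<^sub>n(i)\<close> identifies the value.
\<close>

lemma phi_eq:
  fixes n f i g :: int
  assumes n: "(r k)\<^sup>2 < n" "coprime n (gcd_r k r)"
    and i: "i \<in> Ap (S_r k r) (gcd_r k r * n)"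
    and f: "f \<in> PF (M k r n)" "[f = i] (mod n)"
    and g: "g \<in> PF (M k r (n + r k))" "[g = psi k r n i] (mod (n + r k))"
  shows "phi k r n f = g"
proof -
  have npos: "0 < n + r k" using n(1) r_pos zero_le_power2[of "r k"] by linarith
  have the_i: "(THE j. j \<in> P k r n \<and> [f = j] (mod n)) = i"
  proof (rule the_equality)
    show "i \<in> P k r n \<and> [f = i] (mod n)" using i f by (auto simp: P_def)
    show "j = i" if "j \<in> P k r n \<and> [f = j] (mod n)" for j
      using that f(2) i n Ap_unique[of n j i]
      by (auto simp: P_def S_r_eq gcd_r_def intro: cong_trans cong_sym)
  qed
  show ?thesis unfolding phi_def the_i
  proof (rule the_equality)
    show "h = g" if "h \<in> PF (M k r (n + r k)) \<and> [h = psi k r n i] (mod (n + r k))" for h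
      using that g PF_unique[OF npos] unfolding M_eq by (meson cong_sym cong_trans)
  qed (use g in simp)
qed

lemma phi_formula:
  fixes n f i :: int
  assumes n: "(r k)\<^sup>2 < n" "coprime n (gcd_r k r)"
    and i: "i \<in> Ap (S_r k r) (gcd_r k r * n)"
    and f: "f \<in> PF (M k r n)" "[f = i] (mod n)"
  shows "phi k r n f =
    (if i < gcd_r k r * n - r k then f + (int (min_len k r i) - 1) * r k
     else f + (int (min_len k r i) + 2 * gcd_r k r - 1) * r k + gcd_r k r * n)"
proof -
  let ?d = "Gcd (r ` {1..k})"
  note n' = n[unfolded gcd_r_def] and i' = i[unfolded S_r_eq gcd_r_def]
  have f_eq: "f = i + (int (len i) - 1) * n"
    using PF_eq[OF n' i'] f M_eq by simp
  have f_PF: "i + (int (len i) - 1) * n \<in> PF (shifted n)" using f f_eq M_eq by simp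
  show ?thesis
  proof (cases "i < ?d * n - r k")
    case True
    have "phi k r n f = i + (int (len i) - 1) * (n + r k)"
      using PF_step_low[OF n' i' f_PF True] True
      by (intro phi_eq[OF n i f]) (auto simp: M_eq psi_def gcd_r_def cong_iff_dvd_diff)
    then show ?thesis using True by (simp add: f_eq min_len_eq gcd_r_def algebra_simps)
  next
    case False
    let ?i = "i + ?d * r k"
    have high: "?d * n - r k \<le> i" using False by simp
    have "phi k r n f = ?i + (int (len ?i) - 1) * (n + r k)"
      using PF_step_high(2)[OF n' i' f_PF high] False
      by (intro phi_eq[OF n i f]) (auto simp: M_eq psi_def gcd_r_def cong_iff_dvd_diff)
    then show ?thesis using False PF_step_high(1)[OF n' i' f_PF high]
      by (simp add: f_eq min_len_eq gcd_r_def algebra_simps)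
  qed
qed

end

theorem corollary2p6:
  fixes k :: nat and r :: "nat \<Rightarrow> int" and d n f i :: int
  assumes "k \<ge> 2"
    and "r 0 = 0"
    and "strict_mono_on {0..k} r"
    and "d = gcd_r k r"
    and "n > N0 k r"
    and "coprime n d"
    and "f \<in> PF (M k r n)"
    and "i \<in> Ap (S_r k r) (d * n)"
    and "[f = i] (mod n)"
  shows "phi k r n f =
    (if i < d * n - r k then f + (int (min_len k r i) - 1) * r k
     else f + (int (min_len k r i) + 2 * d - 1) * r k + d * n)"
proof -
  have "(r k)\<^sup>2 < n" using assms(5) by (simp add: N0_def)
  then show ?thesis using assms phi_formula[of k r n i f] by simp
qed

end
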